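(* Let $\lambda$ be a nonzero real number and $m$ a positive integer. For every integer $n\ge 0$, $$\beta_{n,\lambda}(x)=\sum_{k=0}^{n}\Big\{\sum_{l=0}^{n}\sum_{j=k}^{l}\sum_{i=0}^{l-j}\binom{n}{l}\binom{l}{j}\beta_{n-l,\lambda}\,S_{1,\frac{\lambda}{m}}(j,k)\,m^{l-k-i}(-1)^{i}S_{1}(l-j,i)\Big\}d_{m,\lambda}(k,x),$$ where inner sums with lower limit exceeding upper limit are empty.
   Context: For $\mu\neq 0$: $(x)_{0,\mu}=1$ and $(x)_{n,\mu}=x(x-\mu)\cdots(x-(n-1)\mu)$ for $n\ge1$; $e_\mu^{x}(t)=\sum_{k\ge0}(x)_{k,\mu}\frac{t^k}{k!}=(1+\mu t)^{x/\mu}$, $e_\mu(t)=e^1_\mu(t)$, and $\log_\mu(1+t)=\frac{1}{\mu}\big((1+t)^\mu-1\big)$. The degenerate Stirling numbers of the first kind $S_{1,\mu}(n,k)$ are defined by $\frac{1}{k!}(\log_\mu(1+t))^k=\sum_{n\ge k}S_{1,\mu}(n,k)\frac{t^n}{n!}$ (used here with $\mu=\lambda/m$). $S_1(n,k)$ are the (signed) Stirling numbers of the first kind: $x(x-1)\cdots(x-n+1)=\sum_{k=0}^{n}S_1(n,k)x^k$. The degenerate Bernoulli polynomials are defined by $\frac{t}{e_\lambda(t)-1}e_\lambda^{x}(t)=\sum_{n\ge0}\beta_{n,\lambda}(x)\frac{t^n}{n!}$, and $\beta_{n,\lambda}=\beta_{n,\lambda}(0)$. The degenerate Whitney numbers of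 the second kind are defined by $e_\lambda(t)\frac{1}{k!}\Big(\frac{e_\lambda^{m}(t)-1}{m}\Big)^k=\sum_{n\ge k}W_{m,\lambda}(n,k)\frac{t^n}{n!}$, and the fully degenerate Dowling polynomials are $d_{m,\lambda}(n,x)=\sum_{k=0}^{n}W_{m,\lambda}(n,k)(x)_{k,\lambda}$. *)

theory Defs
  imports "HOL-Computational_Algebra.Computational_Algebra"
begin

unbundle fps_syntax

definition deg_ffact :: "real \<Rightarrow> real \<Rightarrow> nat \<Rightarrow> real" where
  "deg_ffact \<mu> x n = (\<Prod>i<n. x - of_nat i * \<mu>)"

definition deg_exp :: "real \<Rightarrow> real \<Rightarrow> real fps" where
  "deg_exp \<mu> x = Abs_fps (\<lambda>k. deg_ffact \<mu> x k / fact k)"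

(* \<open>fps_binomial a\<close> is the series (1 + t)^a, so this is the closed form (1 + \<mu> t)^(x / \<mu>). *)
lemma deg_exp_eq_binomial:
  assumes "\<mu> \<noteq> 0"
  shows "deg_exp \<mu> x = fps_binomial (x / \<mu>) oo (fps_const \<mu> * fps_X)"
proof (rule fps_ext)
  fix n
  have "(\<Prod>i<n. x - of_nat i * \<mu>) = (\<Prod>i<n. \<mu> * (x / \<mu> - of_nat i))"
    by (rule prod.cong) (use assms in \<open>simp_all add: field_simps\<close>)
  also have "\<dots> = \<mu> ^ n * (\<Prod>i<n. x / \<mu> - of_nat i)"
    by (simp add: prod.distrib)
  finally show "deg_exp \<mu> x $ n = (fps_binomial (x / \<mu>) oo (fps_const \<mu> * fps_X)) $ n"
    by (simp add: deg_exp_def deg_ffact_def fps_compose_linear gbinomial_prod_rev atLeast0LessThan)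
qed

(* The series log_\<mu>(1 + t). *)
definition deg_log :: "real \<Rightarrow> real fps" where
  "deg_log \<mu> = fps_const (1 / \<mu>) * (fps_binomial \<mu> - 1)"

(* The number a_n in F = (\<Sum>n. a_n * t^n / n!). *)
definition egf_coeff :: "real fps \<Rightarrow> nat \<Rightarrow> real" where
  "egf_coeff F n = fact n * fps_nth F n"

definition deg_stirling1 :: "real \<Rightarrow> nat \<Rightarrow> nat \<Rightarrow> real" where
  "deg_stirling1 \<mu> n k = egf_coeff (fps_const (1 / fact k) * deg_log \<mu> ^ k) n"

(* Signed, unlike \<open>stirling\<close> of HOL-Combinatorics: the coefficient of x^k in x(x - 1)...(x - n + 1). *)
definition signed_stirling1 :: "nat \<Rightarrow> nat \<Rightarrow> int" where
  "signed_stirling1 n k = coeff (\<Prod>i<n. [:- int i, 1:]) k"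

(* Division of power series cancels the common factor t here; see \<open>deg_bernoulli_divisor\<close> below. *)
definition deg_bernoulli_poly :: "nat \<Rightarrow> real \<Rightarrow> real \<Rightarrow> real" where
  "deg_bernoulli_poly n lam x =
     egf_coeff (fps_X / (deg_exp lam 1 - 1) * deg_exp lam x) n"

abbreviation deg_bernoulli :: "nat \<Rightarrow> real \<Rightarrow> real" where
  "deg_bernoulli n lam \<equiv> deg_bernoulli_poly n lam 0"

lemma deg_bernoulli_divisor:
  "fps_X / (deg_exp lam 1 - 1) * (deg_exp lam 1 - 1) = fps_X"
proof -
  have 0: "(deg_exp lam 1 - 1) $ 0 = 0" and 1: "(deg_exp lam 1 - 1) $ 1 = 1"
    by (simp_all add: deg_exp_def deg_ffact_def)
  have "subdegree (deg_exp lam 1 - 1) = 1"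
    by (rule subdegreeI) (use 0 1 in auto)
  then have "deg_exp lam 1 - 1 dvd fps_X"
    using 1 by (subst fps_dvd_iff) auto
  then show ?thesis
    by simp
qed

definition deg_whitney2 :: "nat \<Rightarrow> real \<Rightarrow> nat \<Rightarrow> nat \<Rightarrow> real" where
  "deg_whitney2 m lam n k =
     egf_coeff (deg_exp lam 1 * (fps_const (1 / fact k) *
       (fps_const (1 / of_nat m) * (deg_exp lam (of_nat m) - 1)) ^ k)) n"

definition deg_dowling_poly :: "nat \<Rightarrow> real \<Rightarrow> nat \<Rightarrow> real \<Rightarrow> real" where
  "deg_dowling_poly m lam n x = (\<Sum>k\<le>n. deg_whitney2 m lam n k * deg_ffact lam x k)"

end

theory Submission
  imports Defs
begin

text \<open>
  Put s = (e_\<lambda>^m(t) - 1) / m. Its compositional inverse is t = (1/m) log_{\<lambda>/m}(1 + m s), and under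
  this substitution e_\<lambda>(t) becomes (1 + m s)^(1/m). The generating function of the Dowling polynomials
  is e_\<lambda>(t) e_\<lambda>^x(s), so e_\<lambda>^x(s) is (1 + m s)^(-1/m) times that function expanded in powers of
  log_{\<lambda>/m}(1 + m s). Multiplying by s / (e_\<lambda>(s) - 1) and comparing coefficients gives the formula.
\<close>

text \<open>Both sides solve (1 + t) y' = a c y with constant term 1, and this equation determines a
  power series up to its constant term.\<close>

lemma fps_binomial_compose_binomial:
  "fps_binomial a oo (fps_binomial c - 1) = fps_binomial (a * c :: real)"
proof -
  let ?F = "fps_binomial a oo (fps_binomial c - 1)"
  have inv: "inverse (1 + fps_X :: real fps) oo (fps_binomial c - 1) = inverse (fps_binomial c)"
    by (subst fps_inverse_compose) (simp_all add: fps_compose_add_distrib)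
  have "fps_deriv ?F =
      fps_const a * (?F * inverse (fps_binomial c)) * (fps_const c * fps_binomial c * inverse (1 + fps_X))"
    by (simp add: fps_compose_deriv fps_binomial_deriv fps_divide_unit fps_compose_mult_distrib inv
        flip: fps_const_mult_apply_left)
  also have "\<dots> = fps_const (a * c) * ?F / (1 + fps_X)"
    using inverse_mult_eq_1[of "fps_binomial c"] by (simp add: fps_divide_unit mult_ac flip: fps_const_mult)
  finally show ?thesis
    by (subst (asm) fps_binomial_ODE_unique) simp
qed

text \<open>Write T for the inner series. Unfolding \<open>deg_log\<close> gives 1 + lam T = (1 + b
  t)^(lam/b), and the power y/lam of this is (1 + b t)^(y/b).\<close>

lemma deg_exp_compose:
  assumes "lam \<noteq> 0" and "b \<noteq> 0"
  shows "deg_exp lam y oo (fps_const (1 / b) * (deg_log (lam / b) oo (fps_const b * fps_X)))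
    = fps_binomial (y / b) oo (fps_const b * fps_X)"
proof -
  let ?bX = "fps_const b * fps_X"
  let ?T = "fps_const (1 / b) * (deg_log (lam / b) oo ?bX)"
  have T0: "?T $ 0 = 0"
    by (simp add: deg_log_def)
  have "fps_const lam * fps_X oo ?T = fps_const lam * ?T"
    by (simp only: fps_compose_mult_distrib[OF T0] fps_const_compose fps_X_fps_compose_startby0[OF T0])
  also have "\<dots> = (fps_const (lam / b) * deg_log (lam / b)) oo ?bX"
    by (simp add: fps_compose_mult_distrib flip: mult.assoc)
  also have "fps_const (lam / b) * deg_log (lam / b) = fps_binomial (lam / b) - 1"
    using assms by (simp add: deg_log_def flip: mult.assoc)
  finally have lamT: "fps_const lam * fps_X oo ?T = (fps_binomial (lam / b) - 1) oo ?bX" .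
  have "deg_exp lam y oo ?T = fps_binomial (y / lam) oo (fps_const lam * fps_X oo ?T)"
    using assms T0 by (simp add: deg_exp_eq_binomial fps_compose_assoc)
  also have "\<dots> = fps_binomial (y / lam) oo (fps_binomial (lam / b) - 1) oo ?bX"
    unfolding lamT by (simp add: fps_compose_assoc)
  also have "\<dots> = fps_binomial (y / b) oo ?bX"
    using assms by (simp add: fps_binomial_compose_binomial)
  finally show ?thesis .
qed

lemma egf_coeff_mult_const_left:
  "egf_coeff (A * (fps_const c * F)) n = c * egf_coeff (A * F) n"
  by (simp add: egf_coeff_def mult.left_commute[of A "fps_const c"])

lemma egf_coeff_mult:
  "egf_coeff (F * G) n = (\<Sum>k\<le>n. of_nat (n choose k) * egf_coeff F k * egf_coeff G (n - k))"
  by (auto simp: egf_coeff_def fps_mult_nth sum_distrib_left binomial_fact atLeast0AtMost intro!: sum.cong)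

text \<open>S^k has no terms below degree k, so only k \<le> n can contribute. The expansion serves
  twice: with S = s it produces the Whitney numbers, and with the inverse series it expands the
  Dowling generating function.\<close>

lemma egf_coeff_mult_compose:
  assumes "S $ 0 = 0"
  shows "egf_coeff (A * (F oo S)) n =
    (\<Sum>k\<le>n. egf_coeff F k * egf_coeff (A * (fps_const (1 / fact k) * S ^ k)) n)"
proof -
  \<comment> \<open>Padding with zeros up to the common bound n makes the range of k independent of
    j, so the sum over k can be exchanged with the convolution sum.\<close>
  have compose: "(F oo S) $ j = (\<Sum>k\<le>n. F $ k * S ^ k $ j)" if "j \<le> n" for j
    unfolding fps_compose_nth
    by (rule sum.mono_neutral_left) (use that assms in \<open>auto simp: startsby_zero_power_prefix\<close>)
  have "(A * (F oo S)) $ n = (\<Sum>i=0..n. A $ i * (\<Sum>k\<le>n. F $ k * S ^ k $ (n - i)))"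
    unfolding fps_mult_nth by (intro sum.cong refl) (simp add: compose)
  also have "\<dots> = (\<Sum>k\<le>n. F $ k * (A * S ^ k) $ n)"
    unfolding fps_mult_nth sum_distrib_left by (subst sum.swap) (simp add: mult.left_commute)
  finally show ?thesis
    unfolding egf_coeff_mult_const_left by (simp add: egf_coeff_def sum_distrib_left mult.left_commute)
qed

text \<open>The weights \<open>deg_ffact lam x k\<close> are the coefficients of
  \<open>deg_exp lam x\<close>, and the Whitney numbers are those of e_\<lambda>(t) s^k / k!, so the
  defining sum is an instance of the preceding expansion.\<close>

lemma deg_dowling_poly_eq_egf_coeff:
  "deg_dowling_poly m lam n x = egf_coeff (deg_exp lam 1 *
     (deg_exp lam x oo (fps_const (1 / of_nat m) * (deg_exp lam (of_nat m) - 1)))) n"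
proof -
  let ?S = "fps_const (1 / of_nat m) * (deg_exp lam (of_nat m) - 1)"
  have "?S $ 0 = 0"
    by (simp add: deg_exp_def deg_ffact_def)
  moreover have "egf_coeff (deg_exp lam x) k = deg_ffact lam x k" for k
    by (simp add: egf_coeff_def deg_exp_def)
  ultimately show ?thesis
    unfolding deg_dowling_poly_def deg_whitney2_def
    by (simp only: egf_coeff_mult_compose mult.commute[of "deg_ffact _ _ _"])
qed

text \<open>The left side is the falling factorial of a, whose coefficients define the Stirling
  numbers; the defining polynomial is over the integers and has to be carried over to the reals
  before evaluation at a.\<close>

lemma gbinomial_eq_sum_signed_stirling1:
  "fact n * (a gchoose n) = (\<Sum>i\<le>n. of_int (signed_stirling1 n i) * (a::real) ^ i)"
proof -
  let ?p = "\<Prod>i<n. [:- int i, 1:]"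
  have "fact n * (a gchoose n) = (\<Prod>i<n. a - of_nat i)"
    by (simp add: gbinomial_prod_rev atLeast0LessThan)
  also have "\<dots> = poly (\<Prod>i<n. [:- of_nat i, 1:]) a"
    by (simp add: poly_prod)
  also have "(\<Prod>i<n. [:- of_nat i, 1:]) = map_poly real_of_int ?p"
  proof (induction n)
    case (Suc n)
    have "map_poly real_of_int (p * q) = map_poly real_of_int p * map_poly real_of_int q" for p q
      by (rule poly_eqI) (simp add: coeff_map_poly coeff_mult)
    then show ?case
      unfolding prod.lessThan_Suc by (simp only: Suc) (simp add: map_poly_pCons)
  qed simp
  also have "poly \<dots> a = (\<Sum>i\<le>n. of_int (signed_stirling1 n i) * a ^ i)"
  proof -
    \<comment> \<open>Each of the n factors is linear and nonzero; the degree supplies the upper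
      bound of the sum in \<open>poly_altdef\<close>.\<close>
    have "degree ?p = n"
      by (simp add: degree_prod_eq_sum_degree)
    then have "degree (map_poly real_of_int ?p) = n"
      by (simp add: degree_map_poly)
    then show ?thesis
      by (simp add: poly_altdef signed_stirling1_def coeff_map_poly)
  qed
  finally show ?thesis .
qed

theorem theorem10:
  fixes lam x :: real and m n :: nat
  assumes "lam \<noteq> 0" and "m > 0"
  shows "deg_bernoulli_poly n lam x =
    (\<Sum>k=0..n.
      (\<Sum>l=0..n. \<Sum>j=k..l. \<Sum>i=0..l-j.
        of_nat (n choose l) * of_nat (l choose j) * deg_bernoulli (n - l) lam
        * deg_stirling1 (lam / of_nat m) j k * of_nat m ^ (l - k - i)
        * (-1) ^ i * of_int (signed_stirling1 (l - j) i))
      * deg_dowling_poly m lam k x)"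
proof -
  define b where "b = real m"
  have b: "b \<noteq> 0"
    using assms by (simp add: b_def)
  define S where "S = fps_const (1 / b) * (deg_exp lam b - 1)"
  define T where "T = fps_const (1 / b) * (deg_log (lam / b) oo (fps_const b * fps_X))"
  define D where "D = deg_exp lam 1 * (deg_exp lam x oo S)"
  \<comment> \<open>P is chosen to cancel what the factor \<open>deg_exp lam 1\<close> of D becomes
    under the substitution of T.\<close>
  define P where "P = fps_binomial (- 1 / b) oo (fps_const b * fps_X)"
  define B where "B = fps_X / (deg_exp lam 1 - 1)"
  have S0: "S $ 0 = 0"
    by (simp add: S_def deg_exp_def deg_ffact_def)
  have T0: "T $ 0 = 0"
    by (simp add: T_def deg_log_def)
  have exp_T: "deg_exp lam y oo T = fps_binomial (y / b) oo (fps_const b * fps_X)" for y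
    unfolding T_def using deg_exp_compose[OF assms(1) b] .
  have "S oo T = fps_X"
  proof -
    \<comment> \<open>In \<open>exp_T\<close> with y = b the exponent b / b is 1, so the binomial
      series reduces to 1 + b X.\<close>
    have "S oo T = fps_const (1 / b) * ((1 + fps_X - 1) oo (fps_const b * fps_X))"
      using b by (simp add: S_def fps_compose_mult_distrib T0 fps_compose_sub_distrib
          fps_compose_add_distrib exp_T fps_binomial_1)
    then show ?thesis
      using b by (simp flip: mult.assoc)
  qed
  then have "D oo T = (fps_binomial (1 / b) oo (fps_const b * fps_X)) * deg_exp lam x"
    by (simp add: D_def fps_compose_mult_distrib T0 exp_T fps_compose_assoc[symmetric] S0)
  moreover have "P * (fps_binomial (1 / b) oo (fps_const b * fps_X)) = 1"
    by (simp add: P_def flip: fps_compose_mult_distrib fps_binomial_add_mult)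
  ultimately have exp_eq: "P * (D oo T) = deg_exp lam x"
    by (simp flip: mult.assoc)
  have P_coeff: "egf_coeff P r = (\<Sum>i=0..r. b ^ (r - i) * (-1) ^ i * of_int (signed_stirling1 r i))" for r
  proof -
    have "egf_coeff P r = b ^ r * (fact r * ((- 1 / b) gchoose r))"
      by (simp add: P_def egf_coeff_def fps_compose_linear)
    \<comment> \<open>Since i \<le> r, the factor b^r absorbs the denominator of (-1/b)^i and leaves
      b^(r - i).\<close>
    also have "\<dots> = (\<Sum>i=0..r. b ^ (r - i) * (-1) ^ i * of_int (signed_stirling1 r i))"
      unfolding gbinomial_eq_sum_signed_stirling1 sum_distrib_left atLeast0AtMost power_divide
      using b by (intro sum.cong refl) (simp add: power_diff)
    finally show ?thesis .
  qed
  \<comment> \<open>Rescaling X to b X multiplies the coefficient at j by b^j, and the prefactors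
    1/b take back b^k. The zero for j < k later cuts the convolution range j \<le> l down to k \<le>
    j.\<close>
  have T_coeff: "egf_coeff (fps_const (1 / fact k) * T ^ k) j =
      (if j < k then 0 else b ^ (j - k) * deg_stirling1 (lam / b) j k)" for j k
  proof (cases "j < k")
    case True
    then show ?thesis
      using T0 by (simp add: egf_coeff_def startsby_zero_power_prefix)
  next
    case False
    have "T ^ k = fps_const (1 / b ^ k) * (deg_log (lam / b) ^ k oo (fps_const b * fps_X))"
      by (simp add: T_def power_mult_distrib fps_compose_power fps_const_power power_divide)
    then show ?thesis
      using False b by (simp add: egf_coeff_def deg_stirling1_def fps_compose_linear power_diff mult.left_commute mult.commute[of "fact k"])
  qed
  have B_coeff: "egf_coeff B r = deg_bernoulli r lam" for r
  proof -
    have "deg_exp lam 0 = 1"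
      using assms by (simp add: deg_exp_eq_binomial)
    then show ?thesis
      by (simp add: deg_bernoulli_poly_def B_def)
  qed
  have PT_coeff: "egf_coeff (fps_const (1 / fact k) * T ^ k * P) l =
      (\<Sum>j=k..l. \<Sum>i=0..l-j. of_nat (l choose j) * deg_stirling1 (lam / b) j k
        * b ^ (l - k - i) * (-1) ^ i * of_int (signed_stirling1 (l - j) i))" for k l
  proof -
    have "egf_coeff (fps_const (1 / fact k) * T ^ k * P) l =
      (\<Sum>j=k..l. of_nat (l choose j) * (b ^ (j - k) * deg_stirling1 (lam / b) j k) * egf_coeff P (l - j))"
      unfolding egf_coeff_mult[of _ P] T_coeff
      by (rule sum.mono_neutral_cong_right) auto
    also have "\<dots> = (\<Sum>j=k..l. \<Sum>i=0..l-j. of_nat (l choose j) * deg_stirling1 (lam / b) j k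
        * b ^ (l - k - i) * (-1) ^ i * of_int (signed_stirling1 (l - j) i))"
      unfolding P_coeff sum_distrib_left
    proof (intro sum.cong refl)
      fix j i assume "j \<in> {k..l}" "i \<in> {0..l-j}"
      \<comment> \<open>The truncated subtractions are exact here because k \<le> j \<le> l and i
        \<le> l - j, so the two powers of b merge.\<close>
      then have "l - k - i = (j - k) + (l - j - i)"
        by auto
      then show "of_nat (l choose j) * (b ^ (j - k) * deg_stirling1 (lam / b) j k) *
          (b ^ (l - j - i) * (-1) ^ i * of_int (signed_stirling1 (l - j) i)) =
        of_nat (l choose j) * deg_stirling1 (lam / b) j k
          * b ^ (l - k - i) * (-1) ^ i * of_int (signed_stirling1 (l - j) i)"
        by (simp add: power_add mult_ac)
    qed
    finally show ?thesis .
  qed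
  have "deg_bernoulli_poly n lam x = egf_coeff ((B * P) * (D oo T)) n"
    by (simp add: deg_bernoulli_poly_def B_def mult.assoc flip: exp_eq)
  \<comment> \<open>B is moved to the end so that the binomial convolution gives index l to T^k P
    and n - l to the Bernoulli numbers.\<close>
  also have "\<dots> = (\<Sum>k\<le>n. egf_coeff (fps_const (1 / fact k) * T ^ k * P * B) n * egf_coeff D k)"
    unfolding egf_coeff_mult_compose[OF T0] by (simp add: mult_ac)
  also have "\<dots> = (\<Sum>k=0..n. (\<Sum>l=0..n. of_nat (n choose l) *
      egf_coeff (fps_const (1 / fact k) * T ^ k * P) l * deg_bernoulli (n - l) lam)
      * deg_dowling_poly m lam k x)"
    by (simp add: egf_coeff_mult[of _ B] B_coeff deg_dowling_poly_eq_egf_coeff D_def S_def b_def atLeast0AtMost)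
  also have "\<dots> = (\<Sum>k=0..n.
      (\<Sum>l=0..n. \<Sum>j=k..l. \<Sum>i=0..l-j.
        of_nat (n choose l) * of_nat (l choose j) * deg_bernoulli (n - l) lam
        * deg_stirling1 (lam / b) j k * b ^ (l - k - i)
        * (-1) ^ i * of_int (signed_stirling1 (l - j) i))
      * deg_dowling_poly m lam k x)"
    unfolding PT_coeff sum_distrib_left sum_distrib_right
    by (intro sum.cong refl) (simp add: mult_ac)
  finally show ?thesis
    unfolding b_def .
qed

end
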